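(* There exists no probability measure $\mu$ on $\{0,1\}^{\mathbb{Z}^2}$ satisfying all of the following conditions: (i) $\mu$ is positively associated; (ii) $\mu$-almost surely there exists a single (i.e. exactly one) infinite $0$cluster; (iii) $\mu$-almost surely there exists at most one infinite $1*$cluster; (iv) $\mu$ satisfies the bounded energy condition; (v) the probability of the event "the node $x$ belongs to the infinite $1*$cluster" is bounded from below by a strictly positive constant not depending on $x\in\mathbb{Z}^2$.
   Context: $\{0,1\}^{\mathbb{Z}^2}$ carries the $\sigma$-algebra generated by the cylinder sets. Two nodes of $\mathbb{Z}^2$ are adjacent if their Euclidean distance is $1$, and $*$adjacent if it is $1$ or $\sqrt2$. For a configuration $\sigma\in\{0,1\}^{\mathbb{Z}^2}$, a $0$cluster is a maximal subset of $\sigma^{-1}(0)$ that is connected with respect to adjacency; a $1*$cluster is a maximal subset of $\sigma^{-1}(1)$ that is connected with respect to $*$adjacency. An event $A\subset\{0,1\}^{\mathbb{Z}^2}$ is increasing if $\xi\in A$ and $\eta\ge\xi$ (pointwise) imply $\eta\in A$. A probability measure $\mu$ on $\{0,1\}^{\mathbb{Z}^2}$ is positively associated if $\mu(A\cap B)\ge\mu(A)\mu(B)$ for all increasing events $A,B$. A probability measure $\mu$ on $\{0,1\}^{\mathbb{Z}^2}$ satisfies the bounded energy condition if for all $n\in\mathbb{N}$ there exists a constant $c_n>0$ such that $\mu(\eta\text{ on }\Delta\mid\xi\text{ off }\Delta)\ge c_n$ for all $\Delta\subset\mathbb{Z}^2$ with $|\Delta|=n$, all $\eta\in\{0,1\}^{\Delta}$,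 and $\mu$-a.e. $\xi\in\{0,1\}^{\Delta^c}$. *)

theory Defs
  imports "HOL-Probability.Probability"
begin

type_synonym node = "int \<times> int"

text \<open>\<open>False\<close> and \<open>True\<close> encode the states 0 and 1; the pointwise order of configurations
  is then the order \<open>\<le>\<close> of the library on functions into \<^typ>\<open>bool\<close>.\<close>

type_synonym config = "node \<Rightarrow> bool"

definition config_space :: "config measure" where
  "config_space = PiM UNIV (\<lambda>_. count_space UNIV)"

definition euclidean_dist :: "node \<Rightarrow> node \<Rightarrow> real" where
  "euclidean_dist x y =
     dist (real_of_int (fst x), real_of_int (snd x)) (real_of_int (fst y), real_of_int (snd y))"

definition adjacent :: "node \<Rightarrow> node \<Rightarrow> bool" where
  "adjacent x y \<longleftrightarrow> euclidean_dist x y = 1"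

definition star_adjacent :: "node \<Rightarrow> node \<Rightarrow> bool" where
  "star_adjacent x y \<longleftrightarrow> euclidean_dist x y = 1 \<or> euclidean_dist x y = sqrt 2"

definition connected_wrt :: "(node \<Rightarrow> node \<Rightarrow> bool) \<Rightarrow> node set \<Rightarrow> bool" where
  "connected_wrt R C \<longleftrightarrow> (\<forall>x\<in>C. \<forall>y\<in>C. (x, y) \<in> {(u, v). u \<in> C \<and> v \<in> C \<and> R u v}\<^sup>*)"

text \<open>The empty set counts as connected here; this is immaterial, since only infinite
  clusters are considered.\<close>

definition maximal_connected_subset ::
    "(node \<Rightarrow> node \<Rightarrow> bool) \<Rightarrow> node set \<Rightarrow> node set \<Rightarrow> bool" where
  "maximal_connected_subset R A C \<longleftrightarrow>
     C \<subseteq> A \<and> connected_wrt R C \<and>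
     (\<forall>D. C \<subseteq> D \<and> D \<subseteq> A \<and> connected_wrt R D \<longrightarrow> D = C)"

definition zero_cluster :: "config \<Rightarrow> node set \<Rightarrow> bool" where
  "zero_cluster \<sigma> C \<longleftrightarrow> maximal_connected_subset adjacent (\<sigma> -` {False}) C"

definition one_star_cluster :: "config \<Rightarrow> node set \<Rightarrow> bool" where
  "one_star_cluster \<sigma> C \<longleftrightarrow> maximal_connected_subset star_adjacent (\<sigma> -` {True}) C"

definition increasing :: "config set \<Rightarrow> bool" where
  "increasing A \<longleftrightarrow> (\<forall>\<xi> \<eta>. \<xi> \<in> A \<and> \<xi> \<le> \<eta> \<longrightarrow> \<eta> \<in> A)"

definition positively_associated :: "config measure \<Rightarrow> bool" where
  "positively_associated \<mu> \<longleftrightarrow>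
     (\<forall>A\<in>sets \<mu>. \<forall>B\<in>sets \<mu>. increasing A \<and> increasing B \<longrightarrow>
        measure \<mu> (A \<inter> B) \<ge> measure \<mu> A * measure \<mu> B)"

text \<open>The \<open>\<sigma>\<close>-algebra on configurations generated by the coordinates off \<open>\<Delta>\<close>.\<close>

definition off :: "node set \<Rightarrow> config measure" where
  "off \<Delta> = vimage_algebra UNIV (\<lambda>\<sigma>. restrict \<sigma> (- \<Delta>)) (PiM (- \<Delta>) (\<lambda>_. count_space UNIV))"

text \<open>\<open>\<mu>(\<eta> on \<Delta> | \<xi> off \<Delta>)\<close> is a version of the conditional expectation, given the coordinates
  off \<open>\<Delta>\<close>, of the indicator of the event that the configuration agrees with \<open>\<eta>\<close> on \<open>\<Delta>\<close>; it is
  evaluated at a full configuration \<open>\<xi>\<close> but is \<open>off \<Delta>\<close>-measurable. Only the values of \<open>\<eta>\<close> on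
  \<open>\<Delta>\<close> matter.\<close>

definition conditional_prob_on_off :: "config measure \<Rightarrow> node set \<Rightarrow> config \<Rightarrow> config \<Rightarrow> real" where
  "conditional_prob_on_off \<mu> \<Delta> \<eta> \<xi> =
     real_cond_exp \<mu> (off \<Delta>) (indicator {\<sigma>. \<forall>x\<in>\<Delta>. \<sigma> x = \<eta> x}) \<xi>"

definition bounded_energy :: "config measure \<Rightarrow> bool" where
  "bounded_energy \<mu> \<longleftrightarrow>
     (\<forall>n::nat. \<exists>c>0. \<forall>\<Delta>. finite \<Delta> \<and> card \<Delta> = n \<longrightarrow>
        (\<forall>\<eta>. AE \<xi> in \<mu>. conditional_prob_on_off \<mu> \<Delta> \<eta> \<xi> \<ge> c))"

text \<open>The library's \<^const>\<open>real_cond_exp\<close> degenerates to 0 unless the following two facts hold.\<close>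

lemma subalgebra_off:
  assumes "sets \<mu> = sets config_space"
  shows "subalgebra \<mu> (off \<Delta>)"
proof -
  have sp: "space \<mu> = UNIV"
    using sets_eq_imp_space_eq[OF assms] by (simp add: config_space_def space_PiM)
  have "(\<lambda>\<sigma>. restrict \<sigma> (- \<Delta>)) \<in> \<mu> \<rightarrow>\<^sub>M PiM (- \<Delta>) (\<lambda>_. count_space UNIV)"
    using measurable_restrict_subset[of "- \<Delta>" UNIV "\<lambda>_. count_space (UNIV :: bool set)"]
    by (simp add: measurable_cong_sets[OF assms refl] config_space_def)
  then have "sets (off \<Delta>) \<subseteq> sets \<mu>"
    unfolding off_def using sp by (intro sets_image_in_sets) auto
  then show ?thesis
    by (simp add: subalgebra_def sp off_def)
qed

lemma sets_agree_on:
  assumes "sets \<mu> = sets config_space" and "finite \<Delta>"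
  shows "{\<sigma>. \<forall>x\<in>\<Delta>. \<sigma> x = \<eta> x} \<in> sets \<mu>"
proof -
  have "{\<sigma> \<in> space config_space. \<forall>x\<in>\<Delta>. \<sigma> x = \<eta> x} \<in> sets config_space"
    unfolding config_space_def using assms(2) by measurable
  then show ?thesis
    by (simp add: assms(1) config_space_def space_PiM)
qed

end

theory Submission
  imports Defs
begin

text \<open>
  Fix a square \<open>Q\<close> around the origin. If outside \<open>Q\<close> there is a closed \<open>*\<close>path of ones whose
  winding number around \<open>Q\<close> is not zero, then no infinite 0cluster can touch \<open>Q\<close>
  (\<open>loop_around_square_blocks\<close>). So it is enough to bound the probability of such a loop from below
  by a constant that does not depend on \<open>Q\<close> (\<open>prob_loops_around\<close>): these events decrease as \<open>Q\<close>
  grows, hence with positive probability every square is surrounded, and then there is no infinite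
  0cluster at all.

  For the bound, let every node be in the infinite \<open>1*\<close>cluster with probability at least \<open>c\<close>. By
  bounded energy, the infinite \<open>1*\<close>cluster stays unique when \<open>Q\<close> is removed (\<open>unique_off\<close>), and
  removing a finite set cuts off only finitely many nodes from infinity, so nodes far away still
  lie in the infinite cluster off \<open>Q\<close> with probability at least \<open>c/2\<close> (\<open>density_off\<close>). By positive
  association any two far nodes \<open>x\<close>, \<open>y\<close> are joined off \<open>Q\<close> with probability at least \<open>c\<^sup>2/4\<close>.
  Classify the paths from \<open>x\<close> to \<open>y\<close> by their signed number of crossings of a ray from the origin to
  infinity, and split at an integer \<open>k\<close>: at least one of the two increasing events ``some path has at
  least \<open>k\<close> crossings'' and ``some path has fewer than \<open>k\<close> crossings'' has probability at least
  \<open>c\<^sup>2/8\<close>. When both occur there is a loop of nonzero winding number, so by positive association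
  the product of their probabilities is at most the probability of a loop.

  Now let \<open>y\<close> make one turn around \<open>Q\<close>, starting and ending at \<open>x\<close>, and let \<open>k\<close> count its
  crossings. At the start the first event has probability at least \<open>c\<close> with \<open>k = 0\<close>, because of the
  trivial path. One step of \<open>y\<close> costs at most a factor \<open>c\<close>. If a step took the probability of the
  first event below \<open>c\<^sup>2/8\<close>, it would still be at least \<open>c\<^sup>3/8\<close>, the second event would have
  probability at least \<open>c\<^sup>2/8\<close>, and the product would be a lower bound for the probability of a loop
  (\<open>high_winding_step\<close>). Otherwise the first event survives the whole turn, and at the end it says
  that some path from \<open>x\<close> to \<open>x\<close> has at least one crossing: a loop around \<open>Q\<close>.
\<close>

section \<open>Paths and winding numbers\<close>

lemma euclidean_dist_eq:
  "euclidean_dist u v = sqrt (real_of_int ((fst u - fst v)\<^sup>2 + (snd u - snd v)\<^sup>2))"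
  by (simp add: euclidean_dist_def dist_prod_def dist_real_def)

lemma adjacent_iff:
  "adjacent u v \<longleftrightarrow> \<bar>fst u - fst v\<bar> + \<bar>snd u - snd v\<bar> = 1"
proof -
  have "adjacent u v \<longleftrightarrow> (fst u - fst v)\<^sup>2 + (snd u - snd v)\<^sup>2 = 1"
    unfolding adjacent_def euclidean_dist_eq real_sqrt_eq_1_iff by linarith
  also have "\<dots> \<longleftrightarrow> \<bar>fst u - fst v\<bar> + \<bar>snd u - snd v\<bar> = 1"
    (is "?x\<^sup>2 + ?y\<^sup>2 = 1 \<longleftrightarrow> _")
  proof
    assume sq: "?x\<^sup>2 + ?y\<^sup>2 = 1"
    then have "\<bar>?x\<bar> \<le> 1" "\<bar>?y\<bar> \<le> 1"
      using zero_le_power2[of ?x] zero_le_power2[of ?y]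
      unfolding abs_square_le_1[symmetric] by linarith+
    then have "?x \<in> {-1, 0, 1}" "?y \<in> {-1, 0, 1}" by auto
    with sq show "\<bar>?x\<bar> + \<bar>?y\<bar> = 1" by auto
  next
    assume "\<bar>?x\<bar> + \<bar>?y\<bar> = 1"
    then have "?x \<in> {-1, 0, 1}" "?y \<in> {-1, 0, 1}" "\<bar>?x\<bar> + \<bar>?y\<bar> = 1" by auto
    then show "?x\<^sup>2 + ?y\<^sup>2 = 1" by auto
  qed
  finally show ?thesis .
qed

lemma star_adjacent_iff:
  "star_adjacent u v \<longleftrightarrow> u \<noteq> v \<and> \<bar>fst u - fst v\<bar> \<le> 1 \<and> \<bar>snd u - snd v\<bar> \<le> 1"
proof -
  have "star_adjacent u v \<longleftrightarrow>
      (fst u - fst v)\<^sup>2 + (snd u - snd v)\<^sup>2 = 1 \<or> (fst u - fst v)\<^sup>2 + (snd u - snd v)\<^sup>2 = 2"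
    unfolding star_adjacent_def euclidean_dist_eq real_sqrt_eq_1_iff real_sqrt_eq_iff
    by linarith
  also have "\<dots> \<longleftrightarrow> u \<noteq> v \<and> \<bar>fst u - fst v\<bar> \<le> 1 \<and> \<bar>snd u - snd v\<bar> \<le> 1"
    (is "?x\<^sup>2 + ?y\<^sup>2 = 1 \<or> _ \<longleftrightarrow> _")
  proof
    assume sq: "?x\<^sup>2 + ?y\<^sup>2 = 1 \<or> ?x\<^sup>2 + ?y\<^sup>2 = 2"
    have "\<bar>i\<bar> \<le> 1" if "i\<^sup>2 \<le> 2" for i :: int
    proof (rule ccontr)
      assume "\<not> \<bar>i\<bar> \<le> 1"
      then have "2\<^sup>2 \<le> \<bar>i\<bar>\<^sup>2" by (intro power_mono) auto
      with that show False by simp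
    qed
    moreover have "?x\<^sup>2 \<le> 2" "?y\<^sup>2 \<le> 2"
      using sq zero_le_power2[of ?x] zero_le_power2[of ?y] by linarith+
    ultimately show "u \<noteq> v \<and> \<bar>?x\<bar> \<le> 1 \<and> \<bar>?y\<bar> \<le> 1" using sq by auto
  next
    assume uv: "u \<noteq> v \<and> \<bar>?x\<bar> \<le> 1 \<and> \<bar>?y\<bar> \<le> 1"
    then have "?x \<in> {-1, 0, 1}" "?y \<in> {-1, 0, 1}" "?x \<noteq> 0 \<or> ?y \<noteq> 0" by (auto simp: prod_eq_iff)
    then show "?x\<^sup>2 + ?y\<^sup>2 = 1 \<or> ?x\<^sup>2 + ?y\<^sup>2 = 2" by auto
  qed
  finally show ?thesis .
qed

lemma star_adjacent_sym: "star_adjacent u v \<longleftrightarrow> star_adjacent v u"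
  by (auto simp: star_adjacent_iff abs_minus_commute)

definition star_path :: "node set \<Rightarrow> node \<Rightarrow> node \<Rightarrow> node list \<Rightarrow> bool" where
  "star_path S u v p \<longleftrightarrow>
     p \<noteq> [] \<and> hd p = u \<and> last p = v \<and> set p \<subseteq> S \<and> successively star_adjacent p"

text \<open>The ray from \<open>z\<close> to the right is pushed up slightly, so that it runs between two rows of nodes:
  a step crosses it if it moves between these rows to the right of \<open>z\<close>, counted positively when it
  moves upwards. For a diagonal step, the column of the endpoint in the row of \<open>z\<close> decides. For a
  closed path that avoids \<open>z\<close>, the total \<open>crossings\<close> is the winding number around \<open>z\<close>.\<close>

definition crossing :: "node \<Rightarrow> node \<Rightarrow> node \<Rightarrow> int" where
  "crossing z u v =
     of_bool (snd u = snd z \<and> fst z < fst u \<and> snd v = snd z + 1) -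
     of_bool (snd v = snd z \<and> fst z < fst v \<and> snd u = snd z + 1)"

fun crossings :: "node \<Rightarrow> node list \<Rightarrow> int" where
  "crossings z (u # v # p) = crossing z u v + crossings z (v # p)"
| "crossings z _ = 0"

lemma crossing_flip: "crossing z v u = - crossing z u v"
  by (simp add: crossing_def)

lemma crossings_append:
  "p \<noteq> [] \<Longrightarrow> crossings z (p @ q) = crossings z p + crossings z (last p # q)"
  by (induction z p rule: crossings.induct) auto

lemma crossings_rev: "crossings z (rev p) = - crossings z p"
proof (induction z p rule: crossings.induct)
  case (1 z u v p)
  have "crossings z (rev (u # v # p)) = crossings z (rev (v # p)) + crossings z [v, u]"
    using crossings_append[of "rev (v # p)" z "[u]"] by simp
  with 1 show ?case by (simp add: crossing_flip[of z v u])
qed auto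

lemma star_path_refl: "u \<in> S \<Longrightarrow> star_path S u u [u]"
  by (simp add: star_path_def)

lemma star_path_snoc:
  assumes "star_path S u v p" "star_adjacent v w" "w \<in> S"
  shows "star_path S u w (p @ [w])" "crossings z (p @ [w]) = crossings z p + crossing z v w"
  using assms by (auto simp: star_path_def successively_append_iff crossings_append)

lemma star_path_append:
  assumes "star_path S u v p" "star_path S v w q"
  shows "star_path S u w (p @ tl q)" "crossings z (p @ tl q) = crossings z p + crossings z q"
proof -
  obtain q' where q: "q = v # q'" using assms(2) by (cases q) (auto simp: star_path_def)
  show "star_path S u w (p @ tl q)"
    using assms unfolding q
    by (cases q') (auto simp: star_path_def successively_append_iff)
  show "crossings z (p @ tl q) = crossings z p + crossings z q"
    using assms(1) unfolding q by (simp add: star_path_def crossings_append)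
qed

lemma star_path_rev: "star_path S u v p \<Longrightarrow> star_path S v u (rev p)"
  by (auto simp: star_path_def hd_rev last_rev successively_rev star_adjacent_sym)

lemma star_path_mono: "star_path S u v p \<Longrightarrow> S \<subseteq> T \<Longrightarrow> star_path T u v p"
  by (auto simp: star_path_def)

text \<open>Comparison of two winding numbers: if the crossings of the two rays differ by a coboundary,
  the totals along a closed path agree.\<close>

lemma crossings_telescope:
  assumes "successively star_adjacent p" "p \<noteq> []"
    and "\<And>u v. u \<in> set p \<Longrightarrow> v \<in> set p \<Longrightarrow> star_adjacent u v \<Longrightarrow>
           crossing z u v = crossing z' u v + f v - f u"
  shows "crossings z p = crossings z' p + f (last p) - f (hd p)"
  using assms
proof (induction z p rule: crossings.induct)
  case (1 z u v p)
  have "crossings z (v # p) = crossings z' (v # p) + f (last (v # p)) - f v"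
    using 1 by simp
  then show ?case using 1 by simp
qed auto

lemma crossings_step_right:
  assumes p: "star_path S x x p" and z: "z = (a, b)" "z' = (a + 1, b)" "z' \<notin> S"
  shows "crossings z p = crossings z' p"
proof -
  have "crossing z u v = crossing z' u v" if "u \<in> set p" "v \<in> set p" for u v
  proof -
    have "u \<noteq> z'" "v \<noteq> z'" using p z that by (auto simp: star_path_def)
    then have "snd w = b \<Longrightarrow> a < fst w \<longleftrightarrow> a + 1 < fst w" if "w \<in> {u, v}" for w
      using that by (auto simp: z prod_eq_iff)
    then show ?thesis by (auto simp: crossing_def z cong: conj_cong)
  qed
  then have "crossings z p = crossings z' p + 0 - 0"
    using p unfolding star_path_def by (intro crossings_telescope[where f = "\<lambda>_. 0"]) auto
  then show ?thesis by simp
qed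

text \<open>The potential \<open>f\<close> is the indicator of the part of the upper row to the right of \<open>z'\<close>. A
  path can enter or leave this half-row only through one of the two rays, since \<open>z\<close> and \<open>z'\<close>
  together block all the ways around its left end, the diagonal ones included.\<close>

lemma crossings_step_up:
  assumes p: "star_path S x x p" and z: "z = (a, b)" "z' = (a, b + 1)" "z \<notin> S" "z' \<notin> S"
  shows "crossings z p = crossings z' p"
proof -
  define f :: "node \<Rightarrow> int" where "f u = of_bool (snd u = b + 1 \<and> a < fst u)" for u
  have step: "crossing z u v = crossing z' u v + f v - f u"
    if "u \<in> set p" "v \<in> set p" "star_adjacent u v" for u v
  proof -
    have avoid: "u \<noteq> z" "u \<noteq> z'" "v \<noteq> z" "v \<noteq> z'" using p z that by (auto simp: star_path_def)
    have dist: "\<bar>fst u - fst v\<bar> \<le> 1" "\<bar>snd u - snd v\<bar> \<le> 1"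
      using that(3) by (auto simp: star_adjacent_iff)
    have side: "a < fst u \<longleftrightarrow> a < fst v"
      if "snd u = b \<or> snd u = b + 1" "snd v = b \<or> snd v = b + 1"
    proof -
      have "fst u \<noteq> a" "fst v \<noteq> a" using that avoid by (auto simp: z prod_eq_iff)
      then show ?thesis using dist(1) by linarith
    qed
    have "snd v = snd u \<or> snd v = snd u + 1 \<or> snd u = snd v + 1" using dist(2) by linarith
    then show ?thesis
    proof (elim disjE)
      assume "snd v = snd u"
      then show ?thesis
        using side by (cases "snd u = b + 1") (simp_all add: crossing_def f_def z)
    next
      assume "snd v = snd u + 1"
      then show ?thesis
        using side by (cases "snd u = b") (simp_all add: crossing_def f_def z)
    next
      assume "snd u = snd v + 1"
      then show ?thesis
        using side by (cases "snd v = b") (auto simp: crossing_def f_def z)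
    qed
  qed
  then have "crossings z p = crossings z' p + f (last p) - f (hd p)"
    using p unfolding star_path_def by (intro crossings_telescope) auto
  then show ?thesis using p by (simp add: star_path_def)
qed

lemma crossings_adjacent:
  assumes "star_path S x x p" "adjacent z z'" "z \<notin> S" "z' \<notin> S"
  shows "crossings z p = crossings z' p"
proof -
  obtain a b a' b' where z: "z = (a, b)" "z' = (a', b')" by (cases z; cases z')
  have "(a' = a + 1 \<and> b' = b) \<or> (a = a' + 1 \<and> b' = b) \<or>
        (a' = a \<and> b' = b + 1) \<or> (a' = a \<and> b = b' + 1)"
    using assms(2) by (auto simp: adjacent_iff z)
  then show ?thesis
    using crossings_step_right[OF assms(1), of z a b z'] crossings_step_right[OF assms(1), of z' a' b' z]
      crossings_step_up[OF assms(1), of z a b z'] crossings_step_up[OF assms(1), of z' a' b' z]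
      assms(3,4) z by metis
qed

definition square :: "nat \<Rightarrow> node set" where
  "square n = {- int n..int n} \<times> {- int n..int n}"

lemma mem_square: "u \<in> square n \<longleftrightarrow> \<bar>fst u\<bar> \<le> int n \<and> \<bar>snd u\<bar> \<le> int n"
  by (cases u) (auto simp: square_def)

lemma finite_square [simp]: "finite (square n)"
  by (simp add: square_def)

lemma square_mono: "m \<le> n \<Longrightarrow> square m \<subseteq> square n"
  by (auto simp: mem_square)

lemma mem_some_square: "\<exists>n. u \<in> square n"
  by (rule exI[of _ "nat (\<bar>fst u\<bar> + \<bar>snd u\<bar>)"]) (auto simp: mem_square)

lemma finite_subset_square: "finite A \<Longrightarrow> \<exists>n. A \<subseteq> square n"
proof (induction A rule: finite_induct)
  case (insert u A)
  then obtain m n where "A \<subseteq> square m" "u \<in> square n" using mem_some_square by blast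
  then have "insert u A \<subseteq> square (max m n)"
    using square_mono[of m "max m n"] square_mono[of n "max m n"] by auto
  then show ?case by blast
qed simp

lemma infinite_iff_leaves_squares: "infinite A \<longleftrightarrow> (\<forall>n. \<exists>y. y \<in> A \<and> y \<notin> square n)"
  using finite_subset_square[of A] finite_subset[OF _ finite_square, of A] by blast

text \<open>If \<open>z\<close> lies to the left of the square, its ray acts on the path as a full line, and \<open>f\<close>
  indicates the half-plane above that line. In all other positions the ray misses the path. The
  auxiliary node \<open>z'\<close> is in the last column, so its ray misses the path, too.\<close>

lemma crossings_outside_square:
  assumes p: "star_path (square n) x x p" and z: "z \<notin> square n"
  shows "crossings z p = 0"
proof -
  define z' :: node where "z' = (int n, snd z)"
  define f :: "node \<Rightarrow> int" where "f u = of_bool (fst z < - int n \<and> snd z < snd u)" for u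
  have "crossings z p = crossings z' p + f (last p) - f (hd p)"
  proof (rule crossings_telescope)
    fix u v assume uv: "u \<in> set p" "v \<in> set p" "star_adjacent u v"
    then have "u \<in> square n" "v \<in> square n" using p by (auto simp: star_path_def)
    then have bounds: "\<bar>fst u\<bar> \<le> int n" "\<bar>fst v\<bar> \<le> int n" "\<bar>snd u\<bar> \<le> int n" "\<bar>snd v\<bar> \<le> int n"
      by (auto simp: mem_square)
    have rows: "snd v = snd u \<or> snd v = snd u + 1 \<or> snd u = snd v + 1"
      using uv(3) unfolding star_adjacent_iff by linarith
    have "\<not> int n < fst u" "\<not> int n < fst v" using bounds by linarith+
    then have z': "crossing z' u v = 0" by (simp add: crossing_def z'_def)
    consider "fst z < - int n" | "int n < fst z"
      | "\<not> fst z < - int n" "snd z < - int n \<or> int n < snd z"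
      using z unfolding mem_square by linarith
    then show "crossing z u v = crossing z' u v + f v - f u"
    proof cases
      case 1
      then have "fst z < fst u" "fst z < fst v" using bounds by linarith+
      with 1 rows show ?thesis unfolding z' unfolding crossing_def f_def by (elim disjE) simp_all
    next
      case 2
      then have "\<not> fst z < fst u" "\<not> fst z < fst v" "\<not> fst z < - int n" using bounds by linarith+
      then show ?thesis unfolding z' by (simp add: crossing_def f_def)
    next
      case 3
      then have "snd u \<noteq> snd z" "snd v \<noteq> snd z" using bounds by linarith+
      with 3(1) show ?thesis unfolding z' by (simp add: crossing_def f_def)
    qed
  qed (use p in \<open>auto simp: star_path_def\<close>)
  moreover have "crossings z' q = 0" if "set q \<subseteq> square n" for q
    using that
  proof (induction q rule: induct_list012)
    case (3 u v q)
    then have "\<bar>fst u\<bar> \<le> int n" "\<bar>fst v\<bar> \<le> int n" by (auto simp: mem_square)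
    then have "\<not> int n < fst u" "\<not> int n < fst v" by linarith+
    with 3 show ?case by (simp add: crossing_def z'_def)
  qed auto
  ultimately show ?thesis using p by (auto simp: star_path_def)
qed

lemma crossings_const_on_connected:
  assumes "star_path S x x p" "connected_wrt adjacent C" "C \<inter> S = {}" "z \<in> C" "z' \<in> C"
  shows "crossings z p = crossings z' p"
proof -
  have "(z, z') \<in> {(u, v). u \<in> C \<and> v \<in> C \<and> adjacent u v}\<^sup>*"
    using assms by (auto simp: connected_wrt_def)
  then show ?thesis
  proof (induction rule: rtrancl_induct)
    case (step v w)
    then show ?case using crossings_adjacent[OF assms(1), of v w] assms(3) by auto
  qed simp
qed

lemma crossings_infinite_connected:
  assumes p: "star_path S x x p" and C: "connected_wrt adjacent C" "C \<inter> S = {}" "infinite C"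
    and z: "z \<in> C"
  shows "crossings z p = 0"
proof -
  obtain n where n: "set p \<subseteq> square n" using finite_subset_square[of "set p"] by blast
  obtain z' where z': "z' \<in> C" "z' \<notin> square n" using C(3) infinite_iff_leaves_squares by blast
  have "crossings z p = crossings z' p"
    using crossings_const_on_connected[OF p C(1,2) z z'(1)] .
  also have "\<dots> = 0"
    using p n z'(2) by (intro crossings_outside_square[of n x]) (auto simp: star_path_def)
  finally show ?thesis .
qed

lemma crossings_const_on_square:
  assumes p: "star_path S x x p" and S: "S \<inter> square n = {}" and z: "z \<in> square n"
  shows "crossings z p = crossings (0, 0) p"
proof -
  have along: "f k = f (0::int)" if "\<And>i. - int n \<le> i \<Longrightarrow> i < int n \<Longrightarrow> f (i + 1) = f i" "\<bar>k\<bar> \<le> int n"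
    for f :: "int \<Rightarrow> int" and k
  proof -
    have const: "f i = f (- int n)" if "- int n \<le> i" "i \<le> int n" for i
      using that
    proof (induction i rule: int_ge_induct)
      case (step i) then show ?case using \<open>\<And>i. - int n \<le> i \<Longrightarrow> i < int n \<Longrightarrow> f (i + 1) = f i\<close>[of i] by simp
    qed simp
    show ?thesis using const[of k] const[of 0] that(2) by simp
  qed
  obtain a b where ab: "z = (a, b)" "\<bar>a\<bar> \<le> int n" "\<bar>b\<bar> \<le> int n" using z by (cases z) (auto simp: mem_square)
  have off: "u \<notin> S" if "u \<in> square n" for u using S that by auto
  have "crossings (a, b) p = crossings (0, b) p"
  proof (rule along)
    fix i :: int assume "- int n \<le> i" "i < int n"
    then show "crossings (i + 1, b) p = crossings (i, b) p"
      using ab(3) by (intro crossings_adjacent[OF p] off) (auto simp: adjacent_iff mem_square)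
  qed (fact ab)
  also have "\<dots> = crossings (0, 0) p"
  proof (rule along[of "\<lambda>i. crossings (0, i) p"])
    fix i :: int assume "- int n \<le> i" "i < int n"
    then show "crossings (0, i + 1) p = crossings (0, i) p"
      by (intro crossings_adjacent[OF p] off) (auto simp: adjacent_iff mem_square)
  qed (fact ab)
  finally show ?thesis using ab by simp
qed

text \<open>The winding number is the same around all nodes of the square, because the loop avoids the
  square and the square is connected. It is also constant on \<open>C\<close>, where it vanishes, because \<open>C\<close>
  reaches points far outside the loop.\<close>

lemma loop_around_square_blocks:
  assumes p: "star_path (S - square n) x x p" "crossings (0, 0) p \<noteq> 0"
    and C: "connected_wrt adjacent C" "infinite C" "C \<inter> S = {}"
  shows "C \<inter> square n = {}"
proof (rule ccontr)
  assume "C \<inter> square n \<noteq> {}"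
  then obtain z where z: "z \<in> C" "z \<in> square n" by blast
  have "crossings (0, 0) p = crossings z p"
    by (rule crossings_const_on_square[OF p(1) _ z(2), symmetric]) auto
  also have "\<dots> = 0"
    using crossings_infinite_connected[OF p(1) C(1) _ C(2) z(1)] C(3) by auto
  finally show False using p(2) by simp
qed

section \<open>Infinite clusters as a path property\<close>

definition joined :: "node set \<Rightarrow> node \<Rightarrow> node \<Rightarrow> bool" where
  "joined S u v \<longleftrightarrow> (\<exists>p. star_path S u v p)"

definition percolates :: "node set \<Rightarrow> node \<Rightarrow> bool" where
  "percolates S u \<longleftrightarrow> infinite {v. joined S u v}"

lemma joined_mem: "joined S u v \<Longrightarrow> u \<in> S \<and> v \<in> S"
  unfolding joined_def star_path_def using hd_in_set last_in_set by blast

lemma joined_refl: "u \<in> S \<Longrightarrow> joined S u u"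
  by (auto simp: joined_def intro: star_path_refl)

lemma joined_sym: "joined S u v \<Longrightarrow> joined S v u"
  by (auto simp: joined_def intro: star_path_rev)

lemma joined_trans: "joined S u v \<Longrightarrow> joined S v w \<Longrightarrow> joined S u w"
  unfolding joined_def by (blast intro: star_path_append)

lemma joined_step: "joined S u v \<Longrightarrow> star_adjacent v w \<Longrightarrow> w \<in> S \<Longrightarrow> joined S u w"
  unfolding joined_def by (blast intro: star_path_snoc)

lemma joined_mono: "joined S u v \<Longrightarrow> S \<subseteq> T \<Longrightarrow> joined T u v"
  unfolding joined_def by (blast intro: star_path_mono)

lemma percolates_mem: "percolates S u \<Longrightarrow> u \<in> S"
  unfolding percolates_def using joined_mem[of S u] not_finite_existsD by blast

lemma percolates_mono: "percolates S u \<Longrightarrow> S \<subseteq> T \<Longrightarrow> percolates T u"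
  unfolding percolates_def by (erule contrapos_nn, erule finite_subset[rotated]) (auto intro: joined_mono)

lemma joined_induct [consumes 1, case_names refl step]:
  assumes "joined S u v" "P u"
    and "\<And>v w. joined S u v \<Longrightarrow> P v \<Longrightarrow> star_adjacent v w \<Longrightarrow> w \<in> S \<Longrightarrow> P w"
  shows "P v"
proof -
  obtain p where "star_path S u v p" using assms(1) by (auto simp: joined_def)
  then show ?thesis
  proof (induction p arbitrary: v rule: rev_induct)
    case (snoc w p)
    show ?case
    proof (cases "p = []")
      case True
      then have "v = u" using snoc.prems by (auto simp: star_path_def)
      then show ?thesis using assms(2) by simp
    next
      case False
      then have "star_path S u (last p) p" "star_adjacent (last p) w" "w \<in> S" "v = w"
        using snoc.prems by (auto simp: star_path_def successively_append_iff)
      then show ?thesis using snoc.IH assms(3)[of "last p" w] by (auto simp: joined_def)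
    qed
  qed (simp add: star_path_def)
qed

lemma maximal_connected_iff_joined:
  "maximal_connected_subset star_adjacent S C \<and> x \<in> C \<longleftrightarrow> x \<in> S \<and> C = {y. joined S x y}"
proof -
  define K where "K = {y. joined S x y}"
  have sub: "D \<subseteq> K" if D: "connected_wrt star_adjacent D" "D \<subseteq> S" "x \<in> D" for D
  proof
    fix y assume "y \<in> D"
    with D have "(x, y) \<in> {(u, v). u \<in> D \<and> v \<in> D \<and> star_adjacent u v}\<^sup>*"
      by (auto simp: connected_wrt_def)
    then show "y \<in> K"
      by (induction rule: rtrancl_induct) (use D in \<open>auto simp: K_def intro: joined_refl joined_step\<close>)
  qed
  have conn: "connected_wrt star_adjacent K" if "x \<in> S"
  proof -
    let ?r = "{(u, v). u \<in> K \<and> v \<in> K \<and> star_adjacent u v}"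
    have "sym ?r" by (auto simp: sym_def star_adjacent_sym)
    have from_x: "(x, y) \<in> ?r\<^sup>*" if "joined S x y" for y
      using that
    proof (induction rule: joined_induct)
      case (step v w)
      then have "(v, w) \<in> ?r" by (auto simp: K_def intro: joined_step)
      with step.IH show ?case by (rule rtrancl_into_rtrancl)
    qed simp
    show ?thesis
      unfolding connected_wrt_def
    proof (intro ballI)
      fix y z assume "y \<in> K" "z \<in> K"
      then have "(x, y) \<in> ?r\<^sup>*" "(x, z) \<in> ?r\<^sup>*" using from_x by (auto simp: K_def)
      then show "(y, z) \<in> ?r\<^sup>*" using \<open>sym ?r\<close> by (meson rtrancl_trans sym_rtrancl symD)
    qed
  qed
  have "K \<subseteq> S" using joined_mem[of S x] unfolding K_def by blast
  have "maximal_connected_subset star_adjacent S C \<and> x \<in> C \<longleftrightarrow> x \<in> S \<and> C = K"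
  proof
    assume C: "maximal_connected_subset star_adjacent S C \<and> x \<in> C"
    then have "x \<in> S" "C \<subseteq> K" using sub unfolding maximal_connected_subset_def by blast+
    then show "x \<in> S \<and> C = K"
      using C conn \<open>K \<subseteq> S\<close> unfolding maximal_connected_subset_def by blast
  next
    assume C: "x \<in> S \<and> C = K"
    moreover have "x \<in> K" using C by (auto simp: K_def intro: joined_refl)
    ultimately show "maximal_connected_subset star_adjacent S C \<and> x \<in> C"
      using conn \<open>K \<subseteq> S\<close> sub unfolding maximal_connected_subset_def by blast
  qed
  then show ?thesis by (simp add: K_def)
qed

definition ones :: "config \<Rightarrow> node set" where
  "ones \<sigma> = {u. \<sigma> u}"

lemma one_star_cluster_iff_joined:
  "one_star_cluster \<sigma> C \<and> x \<in> C \<longleftrightarrow> x \<in> ones \<sigma> \<and> C = {y. joined (ones \<sigma>) x y}"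
proof -
  have "\<sigma> -` {True} = ones \<sigma>" by (auto simp: ones_def)
  then show ?thesis unfolding one_star_cluster_def by (simp add: maximal_connected_iff_joined)
qed

lemma in_infinite_one_star_cluster_iff:
  "(\<exists>C. one_star_cluster \<sigma> C \<and> infinite C \<and> x \<in> C) \<longleftrightarrow> percolates (ones \<sigma>) x"
proof -
  have "(\<exists>C. one_star_cluster \<sigma> C \<and> infinite C \<and> x \<in> C) \<longleftrightarrow>
      (\<exists>C. (one_star_cluster \<sigma> C \<and> x \<in> C) \<and> infinite C)"
    by blast
  then show ?thesis
    unfolding one_star_cluster_iff_joined using percolates_mem[of "ones \<sigma>" x] by (auto simp: percolates_def)
qed

lemma unique_infinite_cluster_joined:
  assumes "\<exists>\<^sub>\<le>\<^sub>1C. one_star_cluster \<sigma> C \<and> infinite C"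
    and "percolates (ones \<sigma>) x" "percolates (ones \<sigma>) y"
  shows "joined (ones \<sigma>) x y"
proof -
  obtain C D where C: "one_star_cluster \<sigma> C" "infinite C" "x \<in> C"
    and D: "one_star_cluster \<sigma> D" "infinite D" "y \<in> D"
    using assms(2,3) unfolding in_infinite_one_star_cluster_iff[symmetric] by blast
  then have "C = D" using assms(1) by (auto dest: Uniq_D)
  then show ?thesis using C D one_star_cluster_iff_joined[of \<sigma> C x] by auto
qed

text \<open>A node outside \<open>B\<close> that \<open>B\<close> cuts off from infinity must be joined off \<open>B\<close> to a neighbour of \<open>B\<close>. There
  are finitely many such neighbours, and only their finite components matter.\<close>

lemma finite_lost_percolation:
  assumes "finite B"
  shows "finite {x. percolates S x \<and> \<not> percolates (S - B) x}"
proof -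
  define nbh where "nbh = (\<lambda>(b::node, d). (fst b + fst d, snd b + snd d)) ` (B \<times> square 1)"
  have "finite nbh" using assms by (simp add: nbh_def)
  have nbh: "v \<in> nbh" if "b \<in> B" "star_adjacent v b" for v b
    unfolding nbh_def
    by (rule image_eqI[of _ _ "(b, (fst v - fst b, snd v - snd b))"])
       (use that in \<open>auto simp: star_adjacent_iff mem_square\<close>)
  have "{x. percolates S x \<and> \<not> percolates (S - B) x} \<subseteq>
      B \<union> (\<Union>v \<in> {v \<in> nbh. \<not> percolates (S - B) v}. {y. joined (S - B) v y})"
  proof
    fix x assume x: "x \<in> {x. percolates S x \<and> \<not> percolates (S - B) x}"
    show "x \<in> B \<union> (\<Union>v \<in> {v \<in> nbh. \<not> percolates (S - B) v}. {y. joined (S - B) v y})"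
    proof (cases "\<exists>v \<in> nbh. joined (S - B) x v")
      case True
      then obtain v where v: "v \<in> nbh" "joined (S - B) x v" by blast
      have "{y. joined (S - B) v y} = {y. joined (S - B) x y}"
        using v(2) joined_trans joined_sym by blast
      then have "\<not> percolates (S - B) v" using x by (simp add: percolates_def)
      then show ?thesis using v joined_sym by blast
    next
      case False
      show ?thesis
      proof (cases "x \<in> B")
        case False
        then have "x \<in> S - B" using x percolates_mem by blast
        have "joined (S - B) x y" if "joined S x y" for y
          using that
        proof (induction rule: joined_induct)
          case refl
          show ?case using \<open>x \<in> S - B\<close> by (rule joined_refl)
        next
          case (step v w)
          then show ?case using nbh[of w v] \<open>\<not> (\<exists>v \<in> nbh. joined (S - B) x v)\<close>
            by (auto intro: joined_step)
        qed
        then have "{y. joined S x y} \<subseteq> {y. joined (S - B) x y}" by blast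
        then show ?thesis using x finite_subset by (auto simp: percolates_def)
      qed simp
    qed
  qed
  moreover have "finite (B \<union> (\<Union>v \<in> {v \<in> nbh. \<not> percolates (S - B) v}. {y. joined (S - B) v y}))"
    using assms \<open>finite nbh\<close> by (auto simp: percolates_def)
  ultimately show ?thesis by (rule finite_subset)
qed

section \<open>Measurability and monotonicity of path events\<close>

lemma space_off: "space (off B) = UNIV"
  by (simp add: off_def)

lemma coordinate_off:
  assumes "u \<notin> B"
  shows "Measurable.pred (off B) (\<lambda>\<sigma>. \<sigma> u)"
proof -
  have "(\<lambda>\<sigma>. restrict \<sigma> (- B)) \<in> off B \<rightarrow>\<^sub>M PiM (- B) (\<lambda>_. count_space UNIV)"
    unfolding off_def by (rule measurable_vimage_algebra1) (auto simp: space_PiM)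
  from measurable_compose[OF this measurable_component_singleton[of u "- B"]]
  have "(\<lambda>\<sigma>. restrict \<sigma> (- B) u) \<in> off B \<rightarrow>\<^sub>M count_space (UNIV :: bool set)"
    using assms by simp
  then show ?thesis using assms by (simp add: restrict_def)
qed

text \<open>There are only countably many paths, and each of them asks for finitely many coordinates.\<close>

lemma path_event_off:
  "Measurable.pred (off B) (\<lambda>\<sigma>. \<exists>p. star_path (ones \<sigma> - B) u v p \<and> Q p)"
proof -
  have eq: "(\<exists>p. star_path (ones \<sigma> - B) u v p \<and> Q p) \<longleftrightarrow>
      (\<exists>p. (star_path (- B) u v p \<and> Q p) \<and> (\<forall>w \<in> set p. w \<notin> B \<longrightarrow> \<sigma> w))" for \<sigma>
    by (intro ex_cong1) (auto simp: star_path_def ones_def)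
  have "Measurable.pred (off B) (\<lambda>\<sigma>. \<forall>w \<in> set p. w \<notin> B \<longrightarrow> \<sigma> w)" for p
    by (intro pred_intros_finite(3) finite_set pred_intros_imp') (rule coordinate_off)
  then show ?thesis
    unfolding eq by (intro pred_intros_countable(2) pred_intros_conj1')
qed

lemma joined_event_off: "Measurable.pred (off B) (\<lambda>\<sigma>. joined (ones \<sigma> - B) u v)"
  using path_event_off[of B u v "\<lambda>_. True"] by (simp add: joined_def)

lemma percolates_event_off: "Measurable.pred (off B) (\<lambda>\<sigma>. percolates (ones \<sigma> - B) u)"
  unfolding percolates_def infinite_iff_leaves_squares mem_Collect_eq
  by (intro pred_intros_countable pred_intros_conj2' joined_event_off)

lemma path_event_in_off: "{\<sigma>. \<exists>p. star_path (ones \<sigma> - B) u v p \<and> Q p} \<in> sets (off B)"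
  using path_event_off[of B u v Q] by (simp add: pred_def space_off)

lemma ones_mono: "\<xi> \<le> \<eta> \<Longrightarrow> ones \<xi> - B \<subseteq> ones \<eta> - B"
  by (auto simp: ones_def le_fun_def)

lemma increasing_path_event: "increasing {\<sigma>. \<exists>p. star_path (ones \<sigma> - B) u v p \<and> Q p}"
  by (auto simp: increasing_def intro: star_path_mono[OF _ ones_mono])

lemma increasing_percolates: "increasing {\<sigma>. percolates (ones \<sigma> - B) u}"
  by (auto simp: increasing_def intro: percolates_mono[OF _ ones_mono])

section \<open>Measures with a unique infinite cluster of positive density\<close>

locale uniform_percolation = prob_space \<mu> for \<mu> :: "config measure" +
  fixes c :: real
  assumes sets_eq: "sets \<mu> = sets config_space"
    and assoc: "positively_associated \<mu>"
    and uniq: "AE \<sigma> in \<mu>. \<exists>\<^sub>\<le>\<^sub>1C. one_star_cluster \<sigma> C \<and> infinite C"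
    and energy: "bounded_energy \<mu>"
    and c_pos: "c > 0"
    and density: "\<And>x. prob {\<sigma>. percolates (ones \<sigma>) x} \<ge> c"
begin

lemma off_event: "A \<in> sets (off B) \<Longrightarrow> A \<in> events"
  using subalgebra_off[OF sets_eq, of B] by (auto simp: subalgebra_def)

lemmas path_event = off_event[OF path_event_in_off]

lemma joined_event: "{\<sigma>. joined (ones \<sigma> - B) u v} \<in> sets (off B)"
  using joined_event_off[of B u v] by (simp add: pred_def space_off)

lemma percolates_event: "{\<sigma>. percolates (ones \<sigma> - B) u} \<in> sets (off B)"
  using percolates_event_off[of B u] by (simp add: pred_def space_off)

lemma harris:
  assumes "A \<in> events" "B \<in> events" "increasing A" "increasing B"
  shows "prob A * prob B \<le> prob (A \<inter> B)"
  using assoc assms unfolding positively_associated_def by blast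

text \<open>Bounded energy: whatever happens off \<open>B\<close>, all nodes of \<open>B\<close> are zero with a conditional
  probability bounded away from 0. So an event off \<open>B\<close> that excludes this is null.\<close>

lemma null_event_off:
  assumes "finite B" "N \<in> sets (off B)" "AE \<sigma> in \<mu>. \<sigma> \<in> N \<longrightarrow> (\<exists>x\<in>B. \<sigma> x)"
  shows "prob N = 0"
proof -
  interpret finite_measure_subalgebra \<mu> "off B"
    by unfold_locales (rule subalgebra_off[OF sets_eq])
  define Z :: "config set" where "Z = {\<sigma>. \<forall>x\<in>B. \<sigma> x = False}"
  have [measurable]: "Z \<in> events"
    unfolding Z_def using sets_agree_on[OF sets_eq assms(1), of "\<lambda>_. False"] by simp
  have [measurable]: "N \<in> events" using off_event[OF assms(2)] .
  obtain d where "d > 0" and d_bound: "\<And>\<Delta> \<eta>. finite \<Delta> \<Longrightarrow> card \<Delta> = card B \<Longrightarrow>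
      AE \<xi> in \<mu>. conditional_prob_on_off \<mu> \<Delta> \<eta> \<xi> \<ge> d"
    using energy unfolding bounded_energy_def by (elim allE[of _ "card B"]) blast
  note d = \<open>d > 0\<close> d_bound[OF assms(1) refl, of "\<lambda>_. False"]
  have ind: "integrable \<mu> (indicator A :: config \<Rightarrow> real)" if "A \<in> events" for A
    using that by (intro integrable_real_indicator) (auto simp: emeasure_eq_measure)
  note int = ind[OF \<open>Z \<in> events\<close>]
  have "d * prob N = (\<integral>\<xi>. indicator N \<xi> * d \<partial>\<mu>)" by simp
  also have "\<dots> \<le> (\<integral>\<xi>. indicator N \<xi> * real_cond_exp \<mu> (off B) (indicator Z) \<xi> \<partial>\<mu>)"
  proof (rule integral_mono_AE)
    show "integrable \<mu> (\<lambda>\<xi>. indicator N \<xi> * real_cond_exp \<mu> (off B) (indicator Z) \<xi>)"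
      using integrable_mult_indicator[OF \<open>N \<in> events\<close> real_cond_exp_int(1)[OF int]] by simp
    show "AE \<xi> in \<mu>. indicator N \<xi> * d \<le> indicator N \<xi> * real_cond_exp \<mu> (off B) (indicator Z) \<xi>"
      using d(2) by eventually_elim (auto simp: conditional_prob_on_off_def Z_def indicator_def)
  qed (use ind[OF \<open>N \<in> events\<close>] in simp)
  also have "\<dots> = (\<integral>\<xi>. indicator N \<xi> * indicator Z \<xi> \<partial>\<mu>)"
    using real_cond_exp_intA[OF int assms(2)] by (simp add: set_lebesgue_integral_def)
  also have "\<dots> = prob (N \<inter> Z)"
    by (simp add: indicator_inter_arith[symmetric])
  also have "\<dots> = 0"
    using assms(3) by (subst prob_eq_0[OF sets.Int[OF \<open>N \<in> events\<close> \<open>Z \<in> events\<close>]]) (auto simp: Z_def)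
  finally show ?thesis using d(1) by (simp add: mult_le_0_iff measure_le_0_iff)
qed

text \<open>If two infinite clusters coexisted off \<open>B\<close>, setting \<open>B\<close> to zero would make them two distinct
  infinite clusters of the whole configuration.\<close>

lemma unique_off:
  assumes "finite B"
  shows "AE \<sigma> in \<mu>. percolates (ones \<sigma> - B) x \<and> percolates (ones \<sigma> - B) y \<longrightarrow>
           joined (ones \<sigma> - B) x y"
proof -
  define N where "N = {\<sigma>. percolates (ones \<sigma> - B) x} \<inter> {\<sigma>. percolates (ones \<sigma> - B) y} -
    {\<sigma>. joined (ones \<sigma> - B) x y}"
  have N: "N \<in> sets (off B)"
    unfolding N_def by (intro sets.Diff sets.Int percolates_event joined_event)
  have "AE \<sigma> in \<mu>. \<sigma> \<in> N \<longrightarrow> (\<exists>x\<in>B. \<sigma> x)"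
    using uniq
  proof eventually_elim
    case (elim \<sigma>)
    show ?case
    proof (rule impI, rule ccontr)
      assume "\<sigma> \<in> N" "\<not> (\<exists>x\<in>B. \<sigma> x)"
      moreover from this have "ones \<sigma> - B = ones \<sigma>" by (auto simp: ones_def)
      ultimately show False
        using unique_infinite_cluster_joined[OF elim, of x y] by (simp add: N_def)
    qed
  qed
  then have "prob N = 0" by (rule null_event_off[OF assms N])
  then have "AE \<sigma> in \<mu>. \<sigma> \<notin> N"
    using off_event[OF N] prob_eq_0 by blast
  then show ?thesis by eventually_elim (auto simp: N_def)
qed

text \<open>For each configuration only finitely many nodes lose their infinite cluster when \<open>B\<close> is removed,
  so the probability that this happens anywhere outside a large square is small.\<close>

lemma density_off:
  assumes "finite B"
  shows "\<exists>R. \<forall>x. x \<notin> square R \<longrightarrow> prob {\<sigma>. percolates (ones \<sigma> - B) x} \<ge> c / 2"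
proof -
  define lost where "lost x = {\<sigma>. percolates (ones \<sigma>) x} - {\<sigma>. percolates (ones \<sigma> - B) x}" for x
  define T where "T R = (\<Union>x\<in>- square R. lost x)" for R
  have perc [measurable]: "{\<sigma>. percolates (ones \<sigma>) x} \<in> events" for x
    using off_event[OF percolates_event[of "{}"]] by simp
  have perc_off [measurable]: "{\<sigma>. percolates (ones \<sigma> - B) x} \<in> events" for x
    by (rule off_event[OF percolates_event])
  have lost [measurable]: "lost x \<in> events" for x by (simp add: lost_def)
  have T [measurable]: "T R \<in> events" for R
    unfolding T_def by (intro sets.countable_UN') auto
  have "decseq T"
    unfolding decseq_def T_def using square_mono by blast
  moreover have "(\<Inter>R. T R) = {}"
  proof -
    have "\<sigma> \<notin> (\<Inter>R. T R)" for \<sigma>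
    proof -
      obtain R where "{x. percolates (ones \<sigma>) x \<and> \<not> percolates (ones \<sigma> - B) x} \<subseteq> square R"
        using finite_subset_square[OF finite_lost_percolation[OF assms]] by blast
      then have "\<sigma> \<notin> T R" by (auto simp: T_def lost_def)
      then show ?thesis by blast
    qed
    then show ?thesis by blast
  qed
  ultimately have "(\<lambda>R. prob (T R)) \<longlonglongrightarrow> 0"
    using finite_Lim_measure_decseq[of T] T by (simp add: image_subset_iff)
  then have "eventually (\<lambda>R. prob (T R) < c / 2) sequentially"
    using c_pos by (intro order_tendstoD) auto
  then obtain R where R: "prob (T R) < c / 2" by (auto simp: eventually_sequentially)
  have "prob {\<sigma>. percolates (ones \<sigma> - B) x} \<ge> c / 2" if "x \<notin> square R" for x
  proof -
    have "c \<le> prob {\<sigma>. percolates (ones \<sigma>) x}" by (rule density)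
    also have "\<dots> \<le> prob ({\<sigma>. percolates (ones \<sigma> - B) x} \<union> T R)"
      using that by (intro finite_measure_mono) (auto simp: T_def lost_def)
    also have "\<dots> \<le> prob {\<sigma>. percolates (ones \<sigma> - B) x} + prob (T R)"
      by (rule measure_Un_le) auto
    finally show ?thesis using R by simp
  qed
  then show ?thesis by blast
qed

lemma occupied: "prob {\<sigma>. \<sigma> x} \<ge> c" "{\<sigma>. \<sigma> x} \<in> events"
proof -
  show ev: "{\<sigma>. \<sigma> x} \<in> events"
    using off_event[of "{\<sigma>. \<sigma> x}" "{}"] coordinate_off[of x "{}"] by (simp add: pred_def space_off)
  have "prob {\<sigma>. percolates (ones \<sigma>) x} \<le> prob {\<sigma>. \<sigma> x}"
    using percolates_mem[of _ x] by (intro finite_measure_mono ev) (auto simp: ones_def)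
  then show "prob {\<sigma>. \<sigma> x} \<ge> c" using density[of x] by simp
qed

section \<open>Loops around a square are uniformly likely\<close>

definition loops_around :: "nat \<Rightarrow> config set" where
  "loops_around n = {\<sigma>. \<exists>x p. star_path (ones \<sigma> - square n) x x p \<and> crossings (0, 0) p \<noteq> 0}"

lemma loops_around_event: "loops_around n \<in> events"
proof -
  have "loops_around n =
      (\<Union>x. {\<sigma>. \<exists>p. star_path (ones \<sigma> - square n) x x p \<and> crossings (0, 0) p \<noteq> 0})"
    by (auto simp: loops_around_def)
  then show ?thesis using path_event by (simp add: sets.countable_UN')
qed

lemma loops_aroundI:
  "star_path (ones \<sigma> - square n) x x p \<Longrightarrow> crossings (0, 0) p \<noteq> 0 \<Longrightarrow> \<sigma> \<in> loops_around n"
  unfolding loops_around_def by blast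

text \<open>A lift of \<open>y\<close> to the universal cover of the complement of the square is a pair of \<open>y\<close> and a
  crossing number. The next two events say that \<open>x\<close> is joined to some lift of \<open>y\<close> that is at or
  above level \<open>k\<close>, or below level \<open>k\<close>, respectively.\<close>

definition high_winding :: "nat \<Rightarrow> node \<Rightarrow> int \<Rightarrow> node \<Rightarrow> config set" where
  "high_winding n x k y =
     {\<sigma>. \<exists>p. star_path (ones \<sigma> - square n) x y p \<and> k \<le> crossings (0, 0) p}"

definition low_winding :: "nat \<Rightarrow> node \<Rightarrow> int \<Rightarrow> node \<Rightarrow> config set" where
  "low_winding n x k y =
     {\<sigma>. \<exists>p. star_path (ones \<sigma> - square n) x y p \<and> crossings (0, 0) p < k}"

lemma winding_events [measurable]: "high_winding n x k y \<in> events" "low_winding n x k y \<in> events"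
  unfolding high_winding_def low_winding_def by (rule path_event)+

lemma increasing_winding: "increasing (high_winding n x k y)" "increasing (low_winding n x k y)"
  unfolding high_winding_def low_winding_def by (rule increasing_path_event)+

text \<open>Almost surely two nodes that percolate off the square are joined off it, and the path that joins
  them has a high or a low winding.\<close>

lemma high_or_low_winding:
  assumes "prob {\<sigma>. percolates (ones \<sigma> - square n) x} \<ge> c / 2"
    and "prob {\<sigma>. percolates (ones \<sigma> - square n) y} \<ge> c / 2"
  shows "prob (high_winding n x k y) + prob (low_winding n x k y) \<ge> c\<^sup>2 / 4"
proof -
  define P where "P u = {\<sigma>. percolates (ones \<sigma> - square n) u}" for u
  have P [measurable]: "P u \<in> events" for u
    unfolding P_def by (rule off_event[OF percolates_event])
  have "c\<^sup>2 / 4 = (c / 2) * (c / 2)" by (simp add: power2_eq_square)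
  also have "\<dots> \<le> prob (P x) * prob (P y)"
    using c_pos assms unfolding P_def by (intro mult_mono) auto
  also have "\<dots> \<le> prob (P x \<inter> P y)"
    by (rule harris[OF P P]) (auto simp: P_def increasing_percolates)
  also have "\<dots> \<le> prob (high_winding n x k y \<union> low_winding n x k y)"
  proof (rule finite_measure_mono_AE)
    show "AE \<sigma> in \<mu>. \<sigma> \<in> P x \<inter> P y \<longrightarrow> \<sigma> \<in> high_winding n x k y \<union> low_winding n x k y"
      using unique_off[OF finite_square, of n x y]
    proof eventually_elim
      case (elim \<sigma>)
      show ?case
      proof
        assume "\<sigma> \<in> P x \<inter> P y"
        then obtain p where "star_path (ones \<sigma> - square n) x y p"
          using elim by (auto simp: P_def joined_def)
        moreover have "k \<le> crossings (0, 0) p \<or> crossings (0, 0) p < k" by linarith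
        ultimately show "\<sigma> \<in> high_winding n x k y \<union> low_winding n x k y"
          unfolding high_winding_def low_winding_def by blast
      qed
    qed
  qed simp
  also have "\<dots> \<le> prob (high_winding n x k y) + prob (low_winding n x k y)"
    by (rule measure_Un_le) auto
  finally show ?thesis .
qed

text \<open>Going from \<open>x\<close> to \<open>y\<close> along the first path and back along the second gives a closed path with a
  positive number of crossings.\<close>

lemma high_and_low_winding:
  "prob (high_winding n x k y) * prob (low_winding n x k y) \<le> prob (loops_around n)"
proof -
  have "prob (high_winding n x k y) * prob (low_winding n x k y) \<le>
      prob (high_winding n x k y \<inter> low_winding n x k y)"
    by (rule harris[OF winding_events increasing_winding])
  also have "\<dots> \<le> prob (loops_around n)"
  proof (rule finite_measure_mono[OF subsetI loops_around_event])
    fix \<sigma> assume "\<sigma> \<in> high_winding n x k y \<inter> low_winding n x k y"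
    then obtain p q where p: "star_path (ones \<sigma> - square n) x y p" "k \<le> crossings (0, 0) p"
      and q: "star_path (ones \<sigma> - square n) x y q" "crossings (0, 0) q < k"
      by (auto simp: high_winding_def low_winding_def)
    note loop = star_path_append[OF p(1) star_path_rev[OF q(1)]]
    have "crossings (0, 0) (p @ tl (rev q)) \<noteq> 0"
      using p(2) q(2) by (simp add: loop(2) crossings_rev)
    with loop(1) show "\<sigma> \<in> loops_around n" by (rule loops_aroundI)
  qed
  finally show ?thesis .
qed

text \<open>A path to \<open>y\<close> extends to \<open>v\<close> as soon as \<open>v\<close> is a one, which costs at most a factor \<open>c\<close> by positive
  association. If the new probability were below \<open>c\<^sup>2/8\<close>, then the low event at \<open>v\<close> would take
  over, and both together would produce loops too often.\<close>

lemma high_winding_step: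
  assumes few_loops: "prob (loops_around n) < c * (c\<^sup>2 / 8)\<^sup>2"
    and dense: "prob {\<sigma>. percolates (ones \<sigma> - square n) x} \<ge> c / 2"
      "prob {\<sigma>. percolates (ones \<sigma> - square n) v} \<ge> c / 2"
    and y: "prob (high_winding n x k y) \<ge> c\<^sup>2 / 8"
    and v: "star_adjacent y v" "v \<notin> square n"
  shows "prob (high_winding n x (k + crossing (0, 0) y v) v) \<ge> c\<^sup>2 / 8"
proof (rule ccontr)
  define l where "l = k + crossing (0, 0) y v"
  have "c * (c\<^sup>2 / 8) \<le> prob {\<sigma>. \<sigma> v} * prob (high_winding n x k y)"
    using occupied(1)[of v] y c_pos by (intro mult_mono) auto
  also have "\<dots> \<le> prob ({\<sigma>. \<sigma> v} \<inter> high_winding n x k y)"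
    by (rule harris[OF occupied(2) winding_events(1) _ increasing_winding(1)])
      (auto simp: increasing_def dest: le_funD[where x = v])
  also have "\<dots> \<le> prob (high_winding n x l v)"
  proof (rule finite_measure_mono[OF subsetI winding_events(1)])
    fix \<sigma> assume "\<sigma> \<in> {\<sigma>. \<sigma> v} \<inter> high_winding n x k y"
    then obtain p where p: "star_path (ones \<sigma> - square n) x y p" "k \<le> crossings (0, 0) p" "\<sigma> v"
      by (auto simp: high_winding_def)
    have "v \<in> ones \<sigma> - square n" using p(3) v(2) by (simp add: ones_def)
    note longer = star_path_snoc[OF p(1) v(1) this]
    have "l \<le> crossings (0, 0) (p @ [v])"
      using p(2) by (simp add: longer(2) l_def)
    with longer(1) show "\<sigma> \<in> high_winding n x l v" unfolding high_winding_def by blast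
  qed
  finally have high: "c * (c\<^sup>2 / 8) \<le> prob (high_winding n x l v)" .
  assume "\<not> c\<^sup>2 / 8 \<le> prob (high_winding n x (k + crossing (0, 0) y v) v)"
  then have low: "c\<^sup>2 / 8 \<le> prob (low_winding n x l v)"
    using high_or_low_winding[OF dense, of l] by (simp add: l_def)
  have "c * (c\<^sup>2 / 8)\<^sup>2 = c * (c\<^sup>2 / 8) * (c\<^sup>2 / 8)" by (simp add: power2_eq_square)
  also have "\<dots> \<le> prob (high_winding n x l v) * prob (low_winding n x l v)"
    using high low c_pos by (intro mult_mono) auto
  also have "\<dots> \<le> prob (loops_around n)" by (rule high_and_low_winding)
  finally show False using few_loops by simp
qed

text \<open>The high event is carried once around the boundary of a square of half side \<open>r\<close>,
  counterclockwise from the lower right corner. The level rises from 0 to 1 where the right side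
  meets the ray.\<close>

lemma prob_loops_around: "c * (c\<^sup>2 / 8)\<^sup>2 \<le> prob (loops_around n)"
proof (rule ccontr)
  assume "\<not> ?thesis"
  then have few_loops: "prob (loops_around n) < c * (c\<^sup>2 / 8)\<^sup>2" by simp
  define a where "a = c\<^sup>2 / 8"
  have "c \<le> 1" using occupied(1)[of undefined] prob_le_1 order_trans by blast
  have a: "0 < a" "a \<le> c" "c * a \<le> 1"
  proof -
    show "0 < a" using c_pos by (simp add: a_def)
    have "c * c \<le> c * 1" using \<open>c \<le> 1\<close> c_pos by (intro mult_left_mono) auto
    then show "a \<le> c" using c_pos by (simp add: a_def power2_eq_square)
    with \<open>c \<le> 1\<close> \<open>0 < a\<close> c_pos show "c * a \<le> 1" by (intro mult_le_one) auto
  qed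
  obtain R0 where R0: "\<And>x. x \<notin> square R0 \<Longrightarrow> prob {\<sigma>. percolates (ones \<sigma> - square n) x} \<ge> c / 2"
    using density_off[OF finite_square] by blast
  define R where "R = max R0 n"
  have out: "x \<notin> square n" "prob {\<sigma>. percolates (ones \<sigma> - square n) x} \<ge> c / 2" if "x \<notin> square R" for x
    using that square_mono[of R0 R] square_mono[of n R] R0[of x] by (auto simp: R_def)
  define r :: int where "r = int R + 1"
  have "r > 0" by (simp add: r_def)
  have out_r: "v \<notin> square R" if "\<bar>fst v\<bar> = r \<or> \<bar>snd v\<bar> = r" for v
    using that by (auto simp: mem_square r_def)
  define x :: node where "x = (r, - r)"
  have x_out: "x \<notin> square R" by (rule out_r) (simp add: x_def r_def)
  define likely where "likely k y \<longleftrightarrow> prob (high_winding n x k y) \<ge> a" for k y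
  have step: "likely (k + crossing (0, 0) y v) v"
    if "likely k y" "star_adjacent y v" "v \<notin> square R" for k y v
    using high_winding_step[OF few_loops out(2)[OF x_out] out(2)[OF that(3)] _ that(2) out(1)[OF that(3)]]
      that(1) by (simp add: likely_def a_def)
  have line: "likely (\<kappa> (int m)) (f (int m))"
    if "likely (\<kappa> 0) (f 0)"
      and "\<And>i. 0 \<le> i \<Longrightarrow> i < int m \<Longrightarrow> star_adjacent (f i) (f (i + 1))"
      and "\<And>i. 0 \<le> i \<Longrightarrow> i < int m \<Longrightarrow> f (i + 1) \<notin> square R"
      and "\<And>i. 0 \<le> i \<Longrightarrow> i < int m \<Longrightarrow> \<kappa> (i + 1) = \<kappa> i + crossing (0, 0) (f i) (f (i + 1))"
    for f :: "int \<Rightarrow> node" and \<kappa> m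
    using that
  proof (induction m)
    case (Suc m)
    have "likely (\<kappa> (int m)) (f (int m))"
      by (rule Suc.IH) (use Suc.prems in auto)
    from step[OF this] Suc.prems(2-4)[of "int m"] show ?case by (simp add: add.commute)
  qed simp
  define s where "s = 2 * (R + 1)"
  have s: "int s = 2 * r" by (simp add: s_def r_def)
  have "likely 0 x"
  proof -
    have "{\<sigma>. \<sigma> x} \<subseteq> high_winding n x 0 x"
    proof
      fix \<sigma> :: config assume "\<sigma> \<in> {\<sigma>. \<sigma> x}"
      then have "star_path (ones \<sigma> - square n) x x [x]"
        using out(1)[OF x_out] by (intro star_path_refl) (simp add: ones_def)
      moreover have "0 \<le> crossings (0, 0) [x]" by simp
      ultimately show "\<sigma> \<in> high_winding n x 0 x" unfolding high_winding_def by blast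
    qed
    then have "prob {\<sigma>. \<sigma> x} \<le> prob (high_winding n x 0 x)" by (intro finite_measure_mono) auto
    then show ?thesis using occupied(1)[of x] a by (simp add: likely_def)
  qed
  have "likely (if r < int s then 1 else 0) (r, int s - r)"
    by (rule line[of "\<lambda>i. if r < i then 1 else 0" "\<lambda>i. (r, i - r)"])
      (use \<open>likely 0 x\<close> \<open>r > 0\<close> in \<open>auto simp: x_def s star_adjacent_iff crossing_def out_r\<close>)
  then have right: "likely 1 (r, r)" using \<open>r > 0\<close> by (simp add: s)
  have "likely 1 (r - int s, r)"
    by (rule line[of "\<lambda>i. 1" "\<lambda>i. (r - i, r)"])
      (use right \<open>r > 0\<close> in \<open>auto simp: s star_adjacent_iff crossing_def out_r\<close>)
  then have top: "likely 1 (- r, r)" by (simp add: s)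
  have "likely 1 (- r, r - int s)"
    by (rule line[of "\<lambda>i. 1" "\<lambda>i. (- r, r - i)"])
      (use top \<open>r > 0\<close> in \<open>auto simp: s star_adjacent_iff crossing_def out_r\<close>)
  then have left: "likely 1 (- r, - r)" by (simp add: s)
  have "likely 1 (int s - r, - r)"
    by (rule line[of "\<lambda>i. 1" "\<lambda>i. (i - r, - r)"])
      (use left \<open>r > 0\<close> in \<open>auto simp: s star_adjacent_iff crossing_def out_r\<close>)
  then have "likely 1 x" by (simp add: s x_def)
  moreover have "high_winding n x 1 x \<subseteq> loops_around n"
  proof
    fix \<sigma> assume "\<sigma> \<in> high_winding n x 1 x"
    then obtain p where "star_path (ones \<sigma> - square n) x x p" "1 \<le> crossings (0, 0) p"
      by (auto simp: high_winding_def)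
    then show "\<sigma> \<in> loops_around n" by (intro loops_aroundI) auto
  qed
  ultimately have "a \<le> prob (loops_around n)"
    using finite_measure_mono[OF _ loops_around_event] unfolding likely_def by (meson order_trans)
  moreover have "c * a * a \<le> 1 * a" using a by (intro mult_right_mono) auto
  ultimately show False using few_loops by (simp add: a_def power2_eq_square)
qed

text \<open>A configuration with loops around all squares has no infinite 0cluster: one of the squares would
  meet it.\<close>

lemma infinite_zero_cluster_not_AE:
  "\<not> (AE \<sigma> in \<mu>. \<exists>C. zero_cluster \<sigma> C \<and> infinite C)"
proof
  assume zero: "AE \<sigma> in \<mu>. \<exists>C. zero_cluster \<sigma> C \<and> infinite C"
  have "decseq loops_around"
    unfolding decseq_def
  proof (intro allI impI subsetI)
    fix m n \<sigma> assume "m \<le> n" "\<sigma> \<in> loops_around n"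
    then obtain x p where p: "star_path (ones \<sigma> - square n) x x p" "crossings (0, 0) p \<noteq> 0"
      by (auto simp: loops_around_def)
    have "ones \<sigma> - square n \<subseteq> ones \<sigma> - square m" using square_mono[OF \<open>m \<le> n\<close>] by blast
    from loops_aroundI[OF star_path_mono[OF p(1) this] p(2)] show "\<sigma> \<in> loops_around m" .
  qed
  then have lim: "(\<lambda>n. prob (loops_around n)) \<longlonglongrightarrow> prob (\<Inter>n. loops_around n)"
    using loops_around_event by (intro finite_Lim_measure_decseq) auto
  have "AE \<sigma> in \<mu>. \<sigma> \<notin> (\<Inter>n. loops_around n)"
    using zero
  proof eventually_elim
    case (elim \<sigma>)
    then obtain C where "zero_cluster \<sigma> C" and inf: "infinite C" by blast
    then have conn: "connected_wrt adjacent C" and "C \<subseteq> \<sigma> -` {False}"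
      unfolding zero_cluster_def maximal_connected_subset_def by blast+
    then have zeros: "C \<inter> ones \<sigma> = {}" unfolding ones_def by blast
    obtain z where z: "z \<in> C" using infinite_imp_nonempty[OF inf] by blast
    obtain n where n: "z \<in> square n" using mem_some_square by blast
    have "\<sigma> \<notin> loops_around n"
    proof
      assume "\<sigma> \<in> loops_around n"
      then obtain x p where "star_path (ones \<sigma> - square n) x x p" "crossings (0, 0) p \<noteq> 0"
        unfolding loops_around_def by blast
      then have "C \<inter> square n = {}" by (rule loop_around_square_blocks[OF _ _ conn inf zeros])
      with z n show False by blast
    qed
    then show ?case by blast
  qed
  then have "prob (\<Inter>n. loops_around n) = 0"
    using prob_eq_0[of "\<Inter>n. loops_around n"] loops_around_event by auto
  moreover have "c * (c\<^sup>2 / 8)\<^sup>2 \<le> prob (\<Inter>n. loops_around n)"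
    using lim prob_loops_around by (intro LIMSEQ_le_const) auto
  ultimately show False using c_pos by (simp add: mult_le_0_iff)
qed

end

theorem theorem1:
  shows "\<not> (\<exists>\<mu> :: config measure.
    prob_space \<mu> \<and> sets \<mu> = sets config_space \<and>
    positively_associated \<mu> \<and>
    (AE \<sigma> in \<mu>. \<exists>!C. zero_cluster \<sigma> C \<and> infinite C) \<and>
    (AE \<sigma> in \<mu>. \<exists>\<^sub>\<le>\<^sub>1C. one_star_cluster \<sigma> C \<and> infinite C) \<and>
    bounded_energy \<mu> \<and>
    (\<exists>c>0. \<forall>x. measure \<mu> {\<sigma>. \<exists>C. one_star_cluster \<sigma> C \<and> infinite C \<and> x \<in> C} \<ge> c))"
proof (intro notI, elim exE conjE)
  fix \<mu> :: "config measure" and c :: real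
  assume *: "prob_space \<mu>" "sets \<mu> = sets config_space" "positively_associated \<mu>"
    "AE \<sigma> in \<mu>. \<exists>!C. zero_cluster \<sigma> C \<and> infinite C"
    "AE \<sigma> in \<mu>. \<exists>\<^sub>\<le>\<^sub>1C. one_star_cluster \<sigma> C \<and> infinite C"
    "bounded_energy \<mu>" "0 < c"
    "\<forall>x. c \<le> measure \<mu> {\<sigma>. \<exists>C. one_star_cluster \<sigma> C \<and> infinite C \<and> x \<in> C}"
  interpret prob_space \<mu> by fact
  interpret uniform_percolation \<mu> c
    using *(1-3,5-7) *(8)[unfolded in_infinite_one_star_cluster_iff, rule_format]
    by unfold_locales
  have "AE \<sigma> in \<mu>. \<exists>C. zero_cluster \<sigma> C \<and> infinite C"
    using *(4) by eventually_elim blast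
  then show False using infinite_zero_cluster_not_AE by contradiction
qed

end
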